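(* Let $\{\xi_n\}_{n\in\mathbb{Z}}$ be a centered stationary Gaussian process with variance $\sigma_\xi^2>0$, and let $$\rho(k):=\operatorname{Corr}(\xi_n,\xi_{n+k}),\qquad k\in\mathbb{Z},$$ denote its autocorrelation function. Assume that $\sum_{k\in\mathbb{Z}}|\rho(k)|<\infty$. Define $\theta_n:=n+\xi_n$ for $n\in\mathbb{Z}$. Then $$S(r):=\frac{1}{2r}\sum_{n\in\mathbb{Z}}\mathbf{1}_{\{|\theta_n|\le r\}}\to 1$$ almost surely as $r\to\infty$ ($r$ real).
   Context: $\operatorname{Corr}(X,Y)=\operatorname{cov}(X,Y)/\sqrt{\operatorname{var}(X)\operatorname{var}(Y)}$; by stationarity $\rho(k)$ does not depend on $n$. $\mathbf{1}_E$ is the indicator of the event $E$. *)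

theory Defs
  imports "HOL-Probability.Probability"
begin

(* The case \<sigma> = 0 is the degenerate Gaussian law, the point mass at \<mu>. *)
definition gaussian_rv :: "'a measure \<Rightarrow> ('a \<Rightarrow> real) \<Rightarrow> bool" where
  "gaussian_rv M X \<longleftrightarrow>
     X \<in> borel_measurable M \<and>
     (\<exists>\<mu> \<sigma>. 0 \<le> \<sigma> \<and>
        distr M borel X =
          (if \<sigma> = 0 then return borel \<mu> else density lborel (\<lambda>x. ennreal (normal_density \<mu> \<sigma> x))))"

definition gaussian_process :: "'a measure \<Rightarrow> ('i \<Rightarrow> 'a \<Rightarrow> real) \<Rightarrow> bool" where
  "gaussian_process M X \<longleftrightarrow>
     (\<forall>J c. finite J \<longrightarrow> gaussian_rv M (\<lambda>\<omega>. \<Sum>j\<in>J. c j * X j \<omega>))"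

(* Strict stationarity: all finite-dimensional laws are invariant under index shifts. *)
definition stationary_process :: "'a measure \<Rightarrow> (int \<Rightarrow> 'a \<Rightarrow> real) \<Rightarrow> bool" where
  "stationary_process M X \<longleftrightarrow>
     (\<forall>J h. finite J \<longrightarrow>
        distr M (PiM J (\<lambda>_. borel)) (\<lambda>\<omega>. \<lambda>j\<in>J. X (j + h) \<omega>) =
        distr M (PiM J (\<lambda>_. borel)) (\<lambda>\<omega>. \<lambda>j\<in>J. X j \<omega>))"

definition covariance :: "'a measure \<Rightarrow> ('a \<Rightarrow> real) \<Rightarrow> ('a \<Rightarrow> real) \<Rightarrow> real" where
  "covariance M X Y =
     (\<integral>\<omega>. (X \<omega> - (\<integral>\<omega>'. X \<omega>' \<partial>M)) * (Y \<omega> - (\<integral>\<omega>'. Y \<omega>' \<partial>M)) \<partial>M)"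

definition correlation :: "'a measure \<Rightarrow> ('a \<Rightarrow> real) \<Rightarrow> ('a \<Rightarrow> real) \<Rightarrow> real" where
  "correlation M X Y =
     covariance M X Y / sqrt (prob_space.variance M X * prob_space.variance M Y)"

(* Based at index 0; for stationary processes the base index is irrelevant, see
   correlation_shift below. *)
definition autocorrelation :: "'a measure \<Rightarrow> (int \<Rightarrow> 'a \<Rightarrow> real) \<Rightarrow> int \<Rightarrow> real" where
  "autocorrelation M X k = correlation M (X 0) (X k)"

definition perturbed_lattice :: "(int \<Rightarrow> 'a \<Rightarrow> real) \<Rightarrow> int \<Rightarrow> 'a \<Rightarrow> real" where
  "perturbed_lattice \<xi> n \<omega> = of_int n + \<xi> n \<omega>"

(* Valued in [0, \<infinity>], so that the sum over all integers is always meaningful: an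
   infinite number of points in [-r, r] gives the value \<infinity>, not 0. *)
definition counting_ratio :: "(int \<Rightarrow> 'a \<Rightarrow> real) \<Rightarrow> real \<Rightarrow> 'a \<Rightarrow> ennreal" where
  "counting_ratio \<theta> r \<omega> =
     (\<Sum>\<^sub>\<infinity>n\<in>UNIV. indicator {\<omega>'. \<bar>\<theta> n \<omega>'\<bar> \<le> r} \<omega>) / ennreal (2 * r)"

lemma gaussian_process_measurable:
  assumes "gaussian_process M X"
  shows "X i \<in> borel_measurable M"
proof -
  have "gaussian_rv M (\<lambda>\<omega>. \<Sum>j\<in>{i}. 1 * X j \<omega>)"
    using assms[unfolded gaussian_process_def, rule_format, of "{i}" "\<lambda>_. 1"] by simp
  then show ?thesis by (simp add: gaussian_rv_def)
qed

lemma stationary_process_integral: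
  fixes f :: "real \<Rightarrow> real \<Rightarrow> real"
  assumes st: "stationary_process M X"
    and X: "\<And>i. X i \<in> borel_measurable M"
    and f: "(\<lambda>(x, y). f x y) \<in> borel_measurable (borel \<Otimes>\<^sub>M borel)"
  shows "(\<integral>\<omega>. f (X (i + h) \<omega>) (X (j + h) \<omega>) \<partial>M) = (\<integral>\<omega>. f (X i \<omega>) (X j \<omega>) \<partial>M)"
proof -
  let ?P = "PiM {i, j} (\<lambda>_. borel :: real measure)"
  have [measurable]: "(\<lambda>\<omega>. \<lambda>l\<in>{i, j}. X (l + g) \<omega>) \<in> M \<rightarrow>\<^sub>M ?P" for g
    by (intro measurable_restrict X)
  have "(\<lambda>y. (y i, y j)) \<in> ?P \<rightarrow>\<^sub>M borel \<Otimes>\<^sub>M borel"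
    by (intro measurable_Pair measurable_component_singleton) auto
  from measurable_compose[OF this f]
  have F: "(\<lambda>y. f (y i) (y j)) \<in> borel_measurable ?P" by simp
  have "(\<integral>\<omega>. f (X (i + g) \<omega>) (X (j + g) \<omega>) \<partial>M) =
        (\<integral>y. f (y i) (y j) \<partial>distr M ?P (\<lambda>\<omega>. \<lambda>l\<in>{i, j}. X (l + g) \<omega>))" for g
    using F by (subst integral_distr) auto
  from this[of h] this[of 0] st show ?thesis
    unfolding stationary_process_def by simp
qed

lemma correlation_shift:
  assumes st: "stationary_process M X" and gp: "gaussian_process M X"
  shows "correlation M (X n) (X (n + k)) = autocorrelation M X k"
proof -
  have I: "(\<integral>\<omega>. f (X n \<omega>) (X (n + k) \<omega>) \<partial>M) = (\<integral>\<omega>. f (X 0 \<omega>) (X k \<omega>) \<partial>M)"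
    if "(\<lambda>(x, y). f x y) \<in> borel_measurable (borel \<Otimes>\<^sub>M borel)" for f :: "real \<Rightarrow> real \<Rightarrow> real"
    using stationary_process_integral[OF st gaussian_process_measurable[OF gp] that, of 0 n k]
    by (simp only: add_0 add.commute[of k n])
  have 1: "(\<integral>\<omega>. X n \<omega> \<partial>M) = (\<integral>\<omega>. X 0 \<omega> \<partial>M)"
    using I[of "\<lambda>x y. x"] by simp
  have 2: "(\<integral>\<omega>. X (n + k) \<omega> \<partial>M) = (\<integral>\<omega>. X k \<omega> \<partial>M)"
    using I[of "\<lambda>x y. y"] by simp
  have "(\<integral>\<omega>. (X n \<omega> - a)\<^sup>2 \<partial>M) = (\<integral>\<omega>. (X 0 \<omega> - a)\<^sup>2 \<partial>M)"
    "(\<integral>\<omega>. (X (n + k) \<omega> - b)\<^sup>2 \<partial>M) = (\<integral>\<omega>. (X k \<omega> - b)\<^sup>2 \<partial>M)"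
    "(\<integral>\<omega>. (X n \<omega> - a) * (X (n + k) \<omega> - b) \<partial>M) = (\<integral>\<omega>. (X 0 \<omega> - a) * (X k \<omega> - b) \<partial>M)"
    for a b
    using I[of "\<lambda>x y. (x - a)\<^sup>2"] I[of "\<lambda>x y. (y - b)\<^sup>2"] I[of "\<lambda>x y. (x - a) * (y - b)"]
    by simp_all
  then show ?thesis
    unfolding autocorrelation_def correlation_def covariance_def 1 2 by simp
qed

end

theory Submission
  imports Defs "HOL-Real_Asymp.Real_Asymp"
begin

text \<open>
  Bounded second moments make \<open>\<Sum>\<^sub>n \<xi>\<^sub>n\<^sup>2 / n\<^sup>2\<close> integrable, so almost surely \<open>\<xi>\<^sub>n / n \<longrightarrow> 0\<close>, that is, for every
  \<open>\<epsilon> > 0\<close> there is a (random) \<open>C\<close> with \<open>\<bar>\<xi>\<^sub>n\<bar> \<le> \<epsilon> \<bar>n\<bar> + C\<close> for all \<open>n\<close>. The set of \<open>n\<close> with \<open>\<bar>n + \<xi>\<^sub>n\<bar> \<le> r\<close>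
  then lies between the integer intervals of radii \<open>(r - C) / (1 + \<epsilon>)\<close> and \<open>(r + C) / (1 - \<epsilon>)\<close>.
\<close>

text \<open>The expectations of \<open>(X n / n)^2\<close> are dominated by the summable series
  \<open>B / n^2\<close>, so by monotone convergence the sum of these squares has finite
  expectation. Hence it is finite almost surely, and its terms tend to 0.\<close>

lemma AE_divide_index_tendsto_0:
  fixes X :: "nat \<Rightarrow> 'a \<Rightarrow> real"
  assumes int: "\<And>n. integrable M (\<lambda>\<omega>. (X n \<omega>)\<^sup>2)"
    and meas [measurable]: "\<And>n. X n \<in> borel_measurable M"
    and bound: "\<And>n. (\<integral>\<omega>. (X n \<omega>)\<^sup>2 \<partial>M) \<le> B"
  shows "AE \<omega> in M. (\<lambda>n. X n \<omega> / real n) \<longlonglongrightarrow> 0"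
proof -
  let ?f = "\<lambda>n \<omega>. (X n \<omega> / real n)\<^sup>2"
  \<comment> \<open>The index 0 causes no trouble: division by zero gives 0, so both sides vanish
    there.\<close>
  have nn: "(\<integral>\<^sup>+\<omega>. ennreal (?f n \<omega>) \<partial>M) \<le> ennreal (B * inverse (real n ^ 2))" for n
  proof -
    have "(\<integral>\<^sup>+\<omega>. ennreal (?f n \<omega>) \<partial>M) = ennreal (\<integral>\<omega>. ?f n \<omega> \<partial>M)"
      using int[of n] by (intro nn_integral_eq_integral) (auto simp: power_divide)
    also have "(\<integral>\<omega>. ?f n \<omega> \<partial>M) = (\<integral>\<omega>. (X n \<omega>)\<^sup>2 \<partial>M) * inverse (real n ^ 2)"
      by (simp add: power_divide divide_inverse[of _ "(real n)\<^sup>2"])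
    also have "\<dots> \<le> B * inverse (real n ^ 2)"
      by (intro mult_right_mono bound) auto
    finally show ?thesis by (simp add: ennreal_leI)
  qed
  have B: "0 \<le> B"
    by (rule order_trans[OF _ bound[of 0]]) simp
  have sm: "summable (\<lambda>n. B * inverse (real n ^ 2))"
    by (intro summable_mult inverse_power_summable) simp
  have "(\<integral>\<^sup>+\<omega>. (\<Sum>n. ennreal (?f n \<omega>)) \<partial>M) = (\<Sum>n. \<integral>\<^sup>+\<omega>. ennreal (?f n \<omega>) \<partial>M)"
    by (intro nn_integral_suminf) measurable
  also have "\<dots> \<le> (\<Sum>n. ennreal (B * inverse (real n ^ 2)))"
    by (intro suminf_le nn) auto
  also have "\<dots> < \<infinity>"
    using B by (subst suminf_ennreal2[OF _ sm]) (auto simp del: suminf_ennreal)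
  finally have "AE \<omega> in M. (\<Sum>n. ennreal (?f n \<omega>)) \<noteq> \<infinity>"
    by (intro nn_integral_PInf_AE) auto
  then show ?thesis
  proof (rule AE_mp, intro AE_I2 impI)
    fix \<omega> assume "(\<Sum>n. ennreal (?f n \<omega>)) \<noteq> \<infinity>"
    then have "summable (\<lambda>n. ?f n \<omega>)"
      by (intro summable_suminf_not_top) auto
    then have "(\<lambda>n. ?f n \<omega>) \<longlonglongrightarrow> 0" by (rule summable_LIMSEQ_zero)
    then have "(\<lambda>n. sqrt (?f n \<omega>)) \<longlonglongrightarrow> sqrt 0" by (rule tendsto_real_sqrt)
    then show "(\<lambda>n. X n \<omega> / real n) \<longlonglongrightarrow> 0"
      by (intro tendsto_rabs_zero_cancel[of "\<lambda>n. X n \<omega> / real n"]) simp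
  qed
qed

text \<open>Only finitely many terms can exceed \<open>\<epsilon> * n\<close>, and the constant
  absorbs those.\<close>

lemma sublinear_imp_affine_bound:
  fixes y :: "nat \<Rightarrow> real"
  assumes "(\<lambda>n. y n / real n) \<longlonglongrightarrow> 0" and "\<epsilon> > 0"
  shows "\<exists>C\<ge>0. \<forall>n. \<bar>y n\<bar> \<le> \<epsilon> * real n + C"
proof -
  have "eventually (\<lambda>n. \<bar>y n / real n\<bar> < \<epsilon>) sequentially"
    using tendstoD[OF assms] by simp
  then obtain N where N: "\<And>n. n \<ge> N \<Longrightarrow> \<bar>y n / real n\<bar> < \<epsilon>"
    by (auto simp: eventually_sequentially)
  \<comment> \<open>The sum dominates each of the finitely many early terms. Index 0, where the
    quotient carries no information about \<open>y 0\<close>, is always among them.\<close>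
  define C where "C = (\<Sum>n\<le>N. \<bar>y n\<bar>)"
  have "C \<ge> 0" by (simp add: C_def sum_nonneg)
  moreover have "\<bar>y n\<bar> \<le> \<epsilon> * real n + C" for n
  proof (cases "n \<le> N")
    case True
    then have "\<bar>y n\<bar> \<le> C" unfolding C_def by (intro member_le_sum) auto
    then show ?thesis using \<open>\<epsilon> > 0\<close> by (simp add: add_increasing)
  next
    case False
    then show ?thesis using N[of n] \<open>C \<ge> 0\<close> by (simp add: field_simps)
  qed
  ultimately show ?thesis by blast
qed

text \<open>For \<open>y \<ge> 0\<close> the set has \<open>2 * \<lfloor>y\<rfloor> + 1\<close>
  elements. For negative \<open>y\<close> it is empty; the lower bound is then negative and still
  true, while the upper bound fails once \<open>y < -1/2\<close>.\<close>

lemma card_int_abs_le: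
  fixes y :: real
  shows "finite {n::int. \<bar>real_of_int n\<bar> \<le> y}"
    and "y \<ge> 0 \<Longrightarrow> real (card {n::int. \<bar>real_of_int n\<bar> \<le> y}) \<le> 2 * y + 1"
    and "real (card {n::int. \<bar>real_of_int n\<bar> \<le> y}) \<ge> 2 * y - 1"
proof -
  have eq: "{n::int. \<bar>real_of_int n\<bar> \<le> y} = {- \<lfloor>y\<rfloor>..\<lfloor>y\<rfloor>}"
    by (auto simp: abs_le_iff le_floor_iff minus_le_iff)
  show "finite {n::int. \<bar>real_of_int n\<bar> \<le> y}" by (simp add: eq)
  show "real (card {n::int. \<bar>real_of_int n\<bar> \<le> y}) \<le> 2 * y + 1" if "y \<ge> 0"
    unfolding eq using that by simp
  show "real (card {n::int. \<bar>real_of_int n\<bar> \<le> y}) \<ge> 2 * y - 1"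
    unfolding eq by simp linarith
qed

text \<open>Finiteness matters here: for an infinite set \<open>card\<close> would be 0, whereas the
  sum of indicators is infinite.\<close>

lemma counting_ratio_eq_card:
  assumes "finite {n. \<bar>\<theta> n \<omega>\<bar> \<le> r}" and "r > 0"
  shows "counting_ratio \<theta> r \<omega> = ennreal (real (card {n. \<bar>\<theta> n \<omega>\<bar> \<le> r}) / (2 * r))"
proof -
  have "(\<Sum>\<^sub>\<infinity>n. indicator {\<omega>'. \<bar>\<theta> n \<omega>'\<bar> \<le> r} \<omega>) = (\<Sum>\<^sub>\<infinity>n\<in>{n. \<bar>\<theta> n \<omega>\<bar> \<le> r}. 1 :: ennreal)"
    by (intro infsum_cong_neutral) auto
  also have "\<dots> = ennreal (real (card {n. \<bar>\<theta> n \<omega>\<bar> \<le> r}))"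
    using assms by (simp add: ennreal_of_nat_eq_real_of_nat)
  finally show ?thesis
    using assms by (simp add: counting_ratio_def divide_ennreal)
qed

text \<open>This is a deterministic statement about one sample path. For fixed
  \<open>\<epsilon>\<close> the constant \<open>C\<close> disappears after division by
  \<open>2 * r\<close>, which leaves the bounds \<open>1 / (1 + \<epsilon>)\<close> and
  \<open>1 / (1 - \<epsilon>)\<close>; then \<open>\<epsilon>\<close> is taken small.\<close>

lemma counting_ratio_tendsto_1:
  assumes affine: "\<And>\<epsilon>. \<epsilon> > 0 \<Longrightarrow> \<exists>C\<ge>0. \<forall>n. \<bar>\<xi> n \<omega>\<bar> \<le> \<epsilon> * \<bar>real_of_int n\<bar> + C"
  shows "((\<lambda>r. counting_ratio (perturbed_lattice \<xi>) r \<omega>) \<longlongrightarrow> 1) at_top"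
proof -
  define A where "A r = {n. \<bar>perturbed_lattice \<xi> n \<omega>\<bar> \<le> r}" for r
  define I where "I y = {n::int. \<bar>real_of_int n\<bar> \<le> y}" for y
  note I = card_int_abs_le[folded I_def]
  have upper: "A r \<subseteq> I ((r + C) / (1 - \<epsilon>))"
    if "\<forall>n. \<bar>\<xi> n \<omega>\<bar> \<le> \<epsilon> * \<bar>real_of_int n\<bar> + C" "\<epsilon> < 1" for r C \<epsilon>
  proof
    fix n assume "n \<in> A r"
    then have "\<bar>real_of_int n\<bar> \<le> r + \<bar>\<xi> n \<omega>\<bar>" by (auto simp: A_def perturbed_lattice_def)
    also have "\<dots> \<le> r + (\<epsilon> * \<bar>real_of_int n\<bar> + C)" using that by simp
    finally show "n \<in> I ((r + C) / (1 - \<epsilon>))" using that by (simp add: I_def field_simps)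
  qed
  have lower: "I ((r - C) / (1 + \<epsilon>)) \<subseteq> A r"
    if "\<forall>n. \<bar>\<xi> n \<omega>\<bar> \<le> \<epsilon> * \<bar>real_of_int n\<bar> + C" "\<epsilon> > 0" for r C \<epsilon>
  proof
    fix n assume "n \<in> I ((r - C) / (1 + \<epsilon>))"
    then have "\<bar>real_of_int n\<bar> + (\<epsilon> * \<bar>real_of_int n\<bar> + C) \<le> r"
      using that by (simp add: I_def field_simps)
    moreover have "\<bar>\<xi> n \<omega>\<bar> \<le> \<epsilon> * \<bar>real_of_int n\<bar> + C" using that by simp
    ultimately show "n \<in> A r" by (simp add: A_def perturbed_lattice_def)
  qed
  \<comment> \<open>Any value of \<open>\<epsilon>\<close> strictly between 0 and 1 would do in
    place of \<open>1/2\<close>.\<close>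
  have fin: "finite (A r)" for r
  proof -
    obtain C where "\<forall>n. \<bar>\<xi> n \<omega>\<bar> \<le> 1/2 * \<bar>real_of_int n\<bar> + C" using affine[of "1/2"] by auto
    from upper[OF this] show ?thesis by (rule finite_subset) (auto intro: I)
  qed
  have "((\<lambda>r. real (card (A r)) / (2 * r)) \<longlongrightarrow> 1) at_top"
  proof (rule order_tendstoI)
    fix a :: real assume "a < 1"
    \<comment> \<open>Since \<open>1 / (1 + \<epsilon>)\<close> tends to 1, a fixed
      \<open>\<epsilon>\<close> can be chosen with this limiting density still above
      \<open>a\<close>.\<close>
    have "((\<lambda>\<epsilon>::real. 1 / (1 + \<epsilon>)) \<longlongrightarrow> 1 / (1 + 0)) (at_right 0)"
      by (intro tendsto_intros) auto
    then have "\<forall>\<^sub>F \<epsilon>::real in at_right 0. a < 1 / (1 + \<epsilon>)"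
      using \<open>a < 1\<close> by (intro order_tendstoD) auto
    then have "\<forall>\<^sub>F \<epsilon>::real in at_right 0. a < 1 / (1 + \<epsilon>) \<and> \<epsilon> > 0"
      by (intro eventually_conj eventually_at_right_less)
    then obtain \<epsilon> :: real where \<epsilon>: "a < 1 / (1 + \<epsilon>)" "\<epsilon> > 0"
      using eventually_happens[of _ "at_right (0::real)"] by auto
    obtain C where C: "\<forall>n. \<bar>\<xi> n \<omega>\<bar> \<le> \<epsilon> * \<bar>real_of_int n\<bar> + C"
      using affine \<epsilon> by blast
    have "((\<lambda>r. (2 * ((r - C) / (1 + \<epsilon>)) - 1) / (2 * r)) \<longlongrightarrow> inverse (1 + \<epsilon>)) at_top"
      using \<epsilon>(2) by real_asymp
    then have "\<forall>\<^sub>F r in at_top. a < (2 * ((r - C) / (1 + \<epsilon>)) - 1) / (2 * r)"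
      by (rule order_tendstoD) (use \<epsilon> in \<open>simp add: inverse_eq_divide\<close>)
    then show "\<forall>\<^sub>F r in at_top. a < real (card (A r)) / (2 * r)"
      using eventually_gt_at_top[of 0]
    proof eventually_elim
      case (elim r)
      have "2 * ((r - C) / (1 + \<epsilon>)) - 1 \<le> real (card (I ((r - C) / (1 + \<epsilon>))))" by (rule I)
      also have "\<dots> \<le> real (card (A r))"
        using card_mono[OF fin lower[OF C \<epsilon>(2)]] by simp
      finally have "(2 * ((r - C) / (1 + \<epsilon>)) - 1) / (2 * r) \<le> real (card (A r)) / (2 * r)"
        using elim by (intro divide_right_mono) auto
      with elim show ?case by linarith
    qed
  next
    fix a :: real assume "1 < a"
    have "((\<lambda>\<epsilon>::real. 1 / (1 - \<epsilon>)) \<longlongrightarrow> 1 / (1 - 0)) (at_right 0)"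
      by (intro tendsto_intros) auto
    then have "\<forall>\<^sub>F \<epsilon>::real in at_right 0. 1 / (1 - \<epsilon>) < a"
      using \<open>1 < a\<close> by (intro order_tendstoD) auto
    \<comment> \<open>The inclusion \<open>upper\<close> divides by \<open>1 - \<epsilon>\<close>,
      so \<open>\<epsilon>\<close> must also stay below 1.\<close>
    moreover have "\<forall>\<^sub>F \<epsilon>::real in at_right 0. \<epsilon> \<in> {0<..<1}"
      by (rule eventually_at_right_real) simp
    ultimately have "\<forall>\<^sub>F \<epsilon>::real in at_right 0. 1 / (1 - \<epsilon>) < a \<and> \<epsilon> \<in> {0<..<1}"
      by (rule eventually_conj)
    then obtain \<epsilon> :: real where \<epsilon>: "1 / (1 - \<epsilon>) < a" "\<epsilon> > 0" "\<epsilon> < 1"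
      using eventually_happens[of _ "at_right (0::real)"] by auto
    obtain C where C: "C \<ge> 0" "\<forall>n. \<bar>\<xi> n \<omega>\<bar> \<le> \<epsilon> * \<bar>real_of_int n\<bar> + C"
      using affine \<epsilon> by blast
    have "((\<lambda>r. (2 * ((r + C) / (1 - \<epsilon>)) + 1) / (2 * r)) \<longlongrightarrow> inverse (1 - \<epsilon>)) at_top"
      using \<epsilon>(3) by real_asymp
    then have "\<forall>\<^sub>F r in at_top. (2 * ((r + C) / (1 - \<epsilon>)) + 1) / (2 * r) < a"
      by (rule order_tendstoD) (use \<epsilon> in \<open>simp add: inverse_eq_divide\<close>)
    then show "\<forall>\<^sub>F r in at_top. real (card (A r)) / (2 * r) < a"
      using eventually_gt_at_top[of 0]
    proof eventually_elim
      case (elim r)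
      have "real (card (A r)) \<le> real (card (I ((r + C) / (1 - \<epsilon>))))"
        using card_mono[OF I(1) upper[OF C(2) \<epsilon>(3)]] by simp
      \<comment> \<open>The upper count requires a nonnegative radius, which
        \<open>C \<ge> 0\<close> and \<open>r > 0\<close> ensure.\<close>
      also have "\<dots> \<le> 2 * ((r + C) / (1 - \<epsilon>)) + 1"
        using elim C \<epsilon> by (intro I) auto
      finally have "real (card (A r)) / (2 * r) \<le> (2 * ((r + C) / (1 - \<epsilon>)) + 1) / (2 * r)"
        using elim by (intro divide_right_mono) auto
      with elim show ?case by linarith
    qed
  qed
  then have "((\<lambda>r. ennreal (real (card (A r)) / (2 * r))) \<longlongrightarrow> 1) at_top"
    using tendsto_ennrealI by fastforce
  moreover have "\<forall>\<^sub>F r in at_top.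
      ennreal (real (card (A r)) / (2 * r)) = counting_ratio (perturbed_lattice \<xi>) r \<omega>"
    using eventually_gt_at_top[of 0]
    by eventually_elim (use fin in \<open>simp add: A_def counting_ratio_eq_card[of "perturbed_lattice \<xi>" \<omega>]\<close>)
  ultimately show ?thesis by (rule Lim_transform_eventually)
qed

theorem lemma2p2:
  fixes M :: "'a measure" and \<xi> :: "int \<Rightarrow> 'a \<Rightarrow> real" and \<sigma> :: real
  assumes "prob_space M"
    and "gaussian_process M \<xi>"
    and "stationary_process M \<xi>"
    and "\<And>n. prob_space.expectation M (\<xi> n) = 0"
    and "\<sigma> > 0"
    and "\<And>n. prob_space.variance M (\<xi> n) = \<sigma>\<^sup>2"
    and "(\<lambda>k. \<bar>autocorrelation M \<xi> k\<bar>) summable_on UNIV"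
  shows "AE \<omega> in M.
    ((\<lambda>r. counting_ratio (perturbed_lattice \<xi>) r \<omega>) \<longlongrightarrow> 1) at_top"
proof -
  have meas: "\<xi> n \<in> borel_measurable M" for n
    by (rule gaussian_process_measurable) fact
  have second_moment: "(\<integral>\<omega>. (\<xi> n \<omega>)\<^sup>2 \<partial>M) = \<sigma>\<^sup>2" for n
    using assms(4,6)[of n] by simp
  \<comment> \<open>A function that is not integrable has integral 0, but \<open>\<sigma>\<^sup>2 > 0\<close>.\<close>
  have int: "integrable M (\<lambda>\<omega>. (\<xi> n \<omega>)\<^sup>2)" for n
    using second_moment[of n] \<open>\<sigma> > 0\<close> not_integrable_integral_eq by fastforce
  \<comment> \<open>The two halves of the integers are treated as separate sequences, both with the
    uniform second moment bound \<open>\<sigma>^2\<close>.\<close>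
  have "AE \<omega> in M. (\<lambda>n. \<xi> (int n) \<omega> / real n) \<longlonglongrightarrow> 0"
    by (rule AE_divide_index_tendsto_0[OF int meas eq_refl[OF second_moment]])
  moreover have "AE \<omega> in M. (\<lambda>n. \<xi> (- int n) \<omega> / real n) \<longlonglongrightarrow> 0"
    by (rule AE_divide_index_tendsto_0[OF int meas eq_refl[OF second_moment]])
  ultimately show ?thesis
  proof eventually_elim
    case (elim \<omega>)
    show ?case
    proof (rule counting_ratio_tendsto_1)
      fix \<epsilon> :: real assume "\<epsilon> > 0"
      obtain C where C: "C \<ge> 0" "\<And>n. \<bar>\<xi> (int n) \<omega>\<bar> \<le> \<epsilon> * real n + C"
        using sublinear_imp_affine_bound[OF elim(1) \<open>\<epsilon> > 0\<close>] by auto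
      obtain D where D: "D \<ge> 0" "\<And>n. \<bar>\<xi> (- int n) \<omega>\<bar> \<le> \<epsilon> * real n + D"
        using sublinear_imp_affine_bound[OF elim(2) \<open>\<epsilon> > 0\<close>] by auto
      \<comment> \<open>As \<open>C\<close> and \<open>D\<close> are nonnegative, their sum serves
        as a constant for both half-lines at once.\<close>
      have "\<bar>\<xi> n \<omega>\<bar> \<le> \<epsilon> * \<bar>real_of_int n\<bar> + (C + D)" for n
      proof (cases n rule: int_cases2)
        case (nonneg k)
        then show ?thesis using C(2)[of k] D(1) by simp
      next
        case (nonpos k)
        then show ?thesis using D(2)[of k] C(1) by simp
      qed
      then show "\<exists>C\<ge>0. \<forall>n. \<bar>\<xi> n \<omega>\<bar> \<le> \<epsilon> * \<bar>real_of_int n\<bar> + C"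
        using C(1) D(1) by (intro exI[of _ "C + D"]) auto
    qed
  qed
qed

end
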